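(* Let $u\ge \ell\ge 1$ be integers, let $n\coloneqq 2^\ell$, and let $\mathcal{H}$ be the set of all linear maps $\mathbb{F}_2^u\to\mathbb{F}_2^\ell$. For any $S\subset \mathbb{F}_2^u$ of cardinality $n$, if $h$ is drawn uniformly at random from $\mathcal{H}$, then \[\mathbb{E}_{h\sim \mathcal{H}}\left[\max_{y\in \mathbb{F}_2^\ell} |h^{-1}(y)\cap S|\right] \le \frac{16\log n}{\log\log n}.\]
   Context: $\log$ denotes the base-2 logarithm. $\mathbb{F}_2$ is the field with two elements. *)

theory Defs
  imports "HOL-Probability.Probability" "HOL-Library.Z2"
begin

instance bit :: finite
proof
  have "(UNIV :: bit set) = {0, 1}"
    using bit_not_zero_iff by auto
  then show "finite (UNIV :: bit set)"
    by (metis finite.emptyI finite.insertI)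
qed

(* Real division satisfies x / 0 = 0, which would turn the bound log n / log (log n) into 0 at
   n = 2.  The quotient is therefore taken in the extended reals, where it is infinite at n = 2
   and agrees with the real quotient for every larger power of two. *)
lemma ereal_bound_at_2: "ereal (16 * log 2 2) / ereal (log 2 (log 2 2)) = \<infinity>"
  by (simp add: divide_ereal_def)

lemma ereal_bound_above_2:
  assumes "l \<ge> 2" and "n = (2 :: nat) ^ l"
  shows "ereal (16 * log 2 n) / ereal (log 2 (log 2 n)) = ereal (16 * log 2 n / log 2 (log 2 n))"
proof -
  have "log 2 (real l) > 0"
    using assms(1) by simp
  then show ?thesis
    using assms(2) by (simp add: ereal_divide log_nat_power)
qed

definition linear_maps :: "(bit ^ 'u \<Rightarrow> bit ^ 'l) set" where
  "linear_maps = {h. Vector_Spaces.linear (*s) (*s) h}"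

(* pmf_of_set is only meaningful for a finite nonempty set. *)
lemma finite_linear_maps: "finite (linear_maps :: (bit ^ 'u \<Rightarrow> bit ^ 'l) set)"
  by simp

lemma linear_maps_nonempty: "(linear_maps :: (bit ^ 'u \<Rightarrow> bit ^ 'l) set) \<noteq> {}"
proof -
  have "(\<lambda>_. 0) \<in> (linear_maps :: (bit ^ 'u \<Rightarrow> bit ^ 'l) set)"
    unfolding linear_maps_def by (simp add: vec.linear_zero)
  then show ?thesis by blast
qed

end

theory Submission
  imports Defs
begin

text \<open>For a linear map \<open>h\<close> into \<open>m\<close> bits let \<open>A h\<close> be the average over all \<open>y\<close> of
  \<open>exp (t * card (h -` {y} \<inter> S))\<close>, and let \<open>a m\<close> be the expectation of \<open>ln (A h)\<close> for uniform
  \<open>h\<close>.  Given a map into \<open>m + 1\<close> bits, add its last row, multiplied by independent random bits, to the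
  other rows and then drop it.  The result is a uniform map into \<open>m\<close> bits; its load vector is the
  sum of the two halves of the old one, shifted against each other at random.  Averaging over the
  shift gives the product of the averages of the two halves, which by AM-GM is at most \<open>(A h)\<^sup>2\<close>.  As
  \<open>ln\<close> is concave, \<open>a m \<le> 2 * a (m + 1)\<close>, hence \<open>2 ^ m * a m\<close> is at most its limit for
  \<open>m \<rightarrow> \<infinity>\<close>.  The probability that \<open>h\<close> is injective on \<open>S\<close> tends to 1, so the limit is at most
  \<open>card S * (exp t - 1)\<close>.  For \<open>card S = 2 ^ l\<close> the expected maximal load is therefore at most
  \<open>(l * ln 2 + exp t - 1) / t\<close>, and \<open>t = ln l\<close> gives the bound.\<close>

section \<open>Dot products over the two-element field\<close>

definition dotp :: "bit ^ 'u \<Rightarrow> bit ^ 'u \<Rightarrow> bit" where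
  "dotp r x = (\<Sum>j\<in>UNIV. r $ j * x $ j)"

lemma dotp_add_left: "dotp (r + s) x = dotp r x + dotp s x"
  by (simp only: dotp_def vector_add_component distrib_right sum.distrib)

lemma dotp_add_right: "dotp r (x + y) = dotp r x + dotp r y"
  by (simp only: dotp_def vector_add_component distrib_left sum.distrib)

lemma dotp_scale_left: "dotp (c *s r) x = c * dotp r x"
  by (simp only: dotp_def vector_smult_component sum_distrib_left mult.assoc)

lemma dotp_axis: "dotp (axis i 1) x = x $ i"
proof -
  have "axis i 1 $ j * x $ j = (if j = i then x $ j else 0)" for j
    by (simp add: axis_def)
  then show ?thesis
    by (simp only: dotp_def) simp
qed

lemma bit_vec_add_self [simp]: "x + x = (0 :: bit ^ 'u)"
  by (simp add: vec_eq_iff)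

lemma bit_vec_add_self_left [simp]: "x + (x + y) = (y :: bit ^ 'u)"
  by (simp add: add.assoc[symmetric])

lemma UNIV_bit: "(UNIV :: bit set) = {0, 1}"
  using bit_not_zero_iff by auto

lemma CARD_bit [simp]: "CARD(bit) = 2"
  by (simp add: UNIV_bit)

text \<open>Adding the unit vector at a coordinate where \<open>z\<close> is nonzero flips
  \<open>dotp r z\<close>, so both values are taken equally often.\<close>

lemma card_dotp_eq_0:
  fixes z :: "bit ^ 'u"
  assumes "z \<noteq> 0"
  shows "2 * card {r. dotp r z = 0} = CARD(bit ^ 'u)"
proof -
  obtain i where i: "z $ i \<noteq> 0"
    using assms by (auto simp: vec_eq_iff)
  have "bij_betw (\<lambda>r. r + axis i 1) {r. dotp r z = 0} {r. dotp r z = 1}"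
    by (rule bij_betw_byWitness[where f' = "\<lambda>r. r + axis i 1"])
      (use i in \<open>auto simp: dotp_add_left dotp_axis add.assoc\<close>)
  then have "card {r. dotp r z = 0} = card {r. dotp r z = 1}"
    by (rule bij_betw_same_card)
  moreover have "(UNIV :: (bit ^ 'u) set) = {r. dotp r z = 0} \<union> {r. dotp r z = 1}"
    using bit_not_zero_iff by auto
  then have "CARD(bit ^ 'u) = card {r. dotp r z = 0} + card {r. dotp r z = 1}"
    by (metis (mono_tags, lifting) card_Un_disjoint disjoint_iff finite mem_Collect_eq zero_neq_one)
  ultimately show ?thesis by simp
qed

section \<open>Averages over finite types and over lists of fixed length\<close>

definition mean :: "('a::finite \<Rightarrow> real) \<Rightarrow> real" where
  "mean f = (\<Sum>x\<in>UNIV. f x) / CARD('a)"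

text \<open>Matrices are handled as lists of rows, so that the number of rows can grow in an
  induction; the dimension of a vector type could not.\<close>

definition list_mean :: "nat \<Rightarrow> ('a::finite list \<Rightarrow> real) \<Rightarrow> real" where
  "list_mean m F = (\<Sum>xs | length xs = m. F xs) / CARD('a) ^ m"

lemma mean_bit: "mean (f :: bit \<Rightarrow> real) = (f 0 + f 1) / 2"
  by (simp add: mean_def UNIV_bit)

lemma mean_mono: "(\<And>x. f x \<le> g x) \<Longrightarrow> mean f \<le> mean g"
  by (simp add: mean_def divide_right_mono sum_mono)

lemma mean_const [simp]: "mean (\<lambda>x::'a::finite. c) = c"
  by (simp add: mean_def)

lemma mean_add: "mean (\<lambda>x. f x + g x) = mean f + mean g"
  by (simp add: mean_def sum.distrib add_divide_distrib)

lemma mean_cmult: "mean (\<lambda>x. c * f x) = c * mean f"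
  by (simp add: mean_def sum_distrib_left)

lemma list_mean_0 [simp]: "list_mean 0 F = F []"
  by (simp add: list_mean_def)

lemma list_mean_Suc:
  "list_mean (Suc m) F = mean (\<lambda>x. list_mean m (\<lambda>xs. F (x # xs)))"
proof -
  have "(\<Sum>xs | length xs = Suc m. F xs) =
      (\<Sum>(x, xs) \<in> UNIV \<times> {xs. length xs = m}. F (x # xs))"
    by (rule sum.reindex_bij_witness
        [where i = "\<lambda>(x, xs). x # xs" and j = "\<lambda>xs. (hd xs, tl xs)"])
      (auto simp: length_Suc_conv)
  also have "\<dots> = (\<Sum>x\<in>UNIV. \<Sum>xs | length xs = m. F (x # xs))"
    by (simp add: sum.cartesian_product)
  finally show ?thesis
    by (simp add: list_mean_def mean_def sum_divide_distrib mult.commute)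
qed

lemma list_mean_mono:
  "(\<And>xs. length xs = m \<Longrightarrow> F xs \<le> G xs) \<Longrightarrow> list_mean m F \<le> list_mean m G"
  unfolding list_mean_def by (intro divide_right_mono sum_mono) auto

lemma list_mean_cong:
  "(\<And>xs. length xs = m \<Longrightarrow> F xs = G xs) \<Longrightarrow> list_mean m F = list_mean m G"
  by (simp add: list_mean_def)

lemma finite_lists_of_length: "finite {xs :: 'a::finite list. length xs = m}"
  using finite_lists_length_eq[of "UNIV :: 'a set" m] by simp

lemma card_lists_of_length: "card {xs :: 'a::finite list. length xs = m} = CARD('a) ^ m"
  using card_lists_length_eq[of "UNIV :: 'a set" m] by simp

lemma list_mean_const [simp]: "list_mean m (\<lambda>xs :: 'a::finite list. c) = c"
  by (simp add: list_mean_def card_lists_of_length)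

lemma list_mean_add: "list_mean m (\<lambda>xs. F xs + G xs) = list_mean m F + list_mean m G"
  by (simp add: list_mean_def sum.distrib add_divide_distrib)

lemma list_mean_cmult: "list_mean m (\<lambda>xs. c * F xs) = c * list_mean m F"
  by (simp add: list_mean_def sum_distrib_left)

lemma list_mean_swap:
  "list_mean m (\<lambda>xs. list_mean k (\<lambda>ys. G xs ys)) = list_mean k (\<lambda>ys. list_mean m (\<lambda>xs. G xs ys))"
proof -
  have "(\<Sum>xs | length xs = m. \<Sum>ys | length ys = k. G xs ys) =
      (\<Sum>ys | length ys = k. \<Sum>xs | length xs = m. G xs ys)"
    by (rule sum.swap)
  then show ?thesis
    by (simp add: list_mean_def sum_divide_distrib[symmetric] mult.commute)
qed

lemma list_mean_pos:
  fixes F :: "'a::finite list \<Rightarrow> real"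
  assumes "\<And>xs. F xs > 0"
  shows "list_mean m F > 0"
proof -
  have "card {xs :: 'a list. length xs = m} > 0"
    by (simp add: card_lists_of_length)
  then have "{xs :: 'a list. length xs = m} \<noteq> {}"
    by (metis card.empty less_irrefl)
  then have "(\<Sum>xs | length xs = m. F xs) > 0"
    by (intro sum_pos finite_lists_of_length assms)
  then show ?thesis
    by (simp add: list_mean_def)
qed

text \<open>Jensen's inequality: \<open>ln\<close> lies below its tangent at the mean
  \<open>M\<close>, and the average of that tangent is \<open>ln M\<close>.\<close>

lemma list_mean_ln_le:
  fixes F :: "'a::finite list \<Rightarrow> real"
  assumes "\<And>xs. F xs > 0"
  shows "list_mean m (\<lambda>xs. ln (F xs)) \<le> ln (list_mean m F)"
proof -
  define M where "M = list_mean m F"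
  have M: "M > 0"
    unfolding M_def by (rule list_mean_pos[OF assms])
  have "list_mean m (\<lambda>xs. ln (F xs)) \<le> list_mean m (\<lambda>xs. (ln M - 1) + (1 / M) * F xs)"
  proof (rule list_mean_mono)
    fix xs :: "'a list"
    have "ln (F xs / M) \<le> F xs / M - 1"
      using assms M by (intro ln_le_minus_one) simp
    then show "ln (F xs) \<le> (ln M - 1) + (1 / M) * F xs"
      using assms[of xs] M by (simp add: ln_div)
  qed
  also have "\<dots> = (ln M - 1) + (1 / M) * M"
    by (simp only: list_mean_add list_mean_cmult list_mean_const M_def)
  also have "\<dots> = ln M"
    using M by simp
  finally show ?thesis
    by (simp add: M_def)
qed

section \<open>Exponential averages of the loads\<close>

text \<open>For the linear map \<open>h\<close> with rows \<open>rs\<close>, this is the average of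
  \<open>exp (t * card (h -` {y} \<inter> T))\<close> over all \<open>y\<close>: each row splits \<open>T\<close> according to one
  coordinate of \<open>y\<close>.\<close>

primrec load_mgf :: "real \<Rightarrow> (bit ^ 'u) list \<Rightarrow> (bit ^ 'u) set \<Rightarrow> real" where
  "load_mgf t [] T = exp (t * card T)"
| "load_mgf t (r # rs) T =
    (load_mgf t rs {x \<in> T. dotp r x = 0} + load_mgf t rs {x \<in> T. dotp r x = 1}) / 2"

lemma load_mgf_pos: "load_mgf t rs T > 0"
  by (induction rs arbitrary: T) (auto intro: add_pos_pos)

text \<open>The left side is one of the \<open>2 ^ length rs\<close> terms being averaged, and all
  of them are positive.\<close>

lemma exp_load_le_load_mgf:
  fixes t :: real
  assumes "length ys = length rs"
  shows "exp (t * card {x \<in> T. map (\<lambda>r. dotp r x) rs = ys}) \<le> 2 ^ length rs * load_mgf t rs T"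
  using assms
proof (induction rs arbitrary: ys T)
  case Nil
  then show ?case by simp
next
  case (Cons r rs)
  then obtain y ys' where ys: "ys = y # ys'" "length ys' = length rs"
    by (cases ys) auto
  have eq: "{x \<in> T. map (\<lambda>r. dotp r x) (r # rs) = ys} =
      {x \<in> {x \<in> T. dotp r x = y}. map (\<lambda>r. dotp r x) rs = ys'}"
    using ys by auto
  have "load_mgf t rs {x \<in> T. dotp r x = y} \<le>
      load_mgf t rs {x \<in> T. dotp r x = 0} + load_mgf t rs {x \<in> T. dotp r x = 1}"
    using load_mgf_pos[of t rs "{x \<in> T. dotp r x = 0}"]
      load_mgf_pos[of t rs "{x \<in> T. dotp r x = 1}"]
    by (cases y) auto
  then have "2 ^ length rs * load_mgf t rs {x \<in> T. dotp r x = y} \<le>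
      2 ^ length (r # rs) * load_mgf t (r # rs) T"
    by simp
  with Cons.IH[OF ys(2), of "{x \<in> T. dotp r x = y}"] show ?case
    unfolding eq by linarith
qed

section \<open>Random shears\<close>

definition shear :: "bit ^ 'u \<Rightarrow> (bit ^ 'u) list \<Rightarrow> bit list \<Rightarrow> (bit ^ 'u) list" where
  "shear r rs cs = map2 (\<lambda>s c. s + c *s r) rs cs"

lemma shear_simps [simp]:
  "shear r [] [] = []"
  "shear r (s # rs) (c # cs) = (s + c *s r) # shear r rs cs"
  by (simp_all add: shear_def)

lemma shear_shear: "length rs = length cs \<Longrightarrow> shear r (shear r rs cs) cs = rs"
  by (induction rs cs rule: list_induct2) (simp_all add: add.assoc)

text \<open>In characteristic 2 a shear with fixed \<open>r\<close> and \<open>cs\<close> is an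
  involution, so it permutes the lists of length \<open>m\<close>.\<close>

lemma list_mean_shear:
  assumes "length cs = m"
  shows "list_mean m (\<lambda>rs. F (shear r rs cs)) = list_mean m F"
proof -
  have "(\<Sum>rs | length rs = m. F (shear r rs cs)) = (\<Sum>rs | length rs = m. F rs)"
    by (rule sum.reindex_bij_witness[where i = "\<lambda>rs. shear r rs cs" and j = "\<lambda>rs. shear r rs cs"])
      (use assms in \<open>auto simp: shear_shear, auto simp: shear_def\<close>)
  then show ?thesis
    by (simp add: list_mean_def)
qed

text \<open>A random shear shifts the two halves of the load vector by a uniformly random vector
  relative to each other, which makes them independent.\<close>

lemma list_mean_load_mgf_shear:
  fixes r :: "bit ^ 'u"
  assumes "\<And>x. x \<in> T0 \<Longrightarrow> dotp r x = 0" "\<And>x. x \<in> T1 \<Longrightarrow> dotp r x = 1"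
  shows "list_mean (length rs) (\<lambda>cs. load_mgf t (shear r rs cs) (T0 \<union> T1)) =
    load_mgf t rs T0 * load_mgf t rs T1"
  using assms
proof (induction rs arbitrary: T0 T1)
  case Nil
  have "T0 \<inter> T1 = {}"
    using Nil by force
  then have "card (T0 \<union> T1) = card T0 + card T1"
    by (simp add: card_Un_disjoint)
  then show ?case
    by (simp add: distrib_left exp_add)
next
  case (Cons s rs)
  let ?P = "\<lambda>T b. {x \<in> T. dotp s x = b}"
  \<comment> \<open>Adding \<open>c *s r\<close> to \<open>s\<close> changes nothing on
    \<open>T0\<close>, where \<open>r\<close> vanishes, and shifts the value by \<open>c\<close> on
    \<open>T1\<close>.\<close>
  have split: "{x \<in> T0 \<union> T1. dotp (s + c *s r) x = b} = ?P T0 b \<union> ?P T1 (b + c)" for b c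
    using Cons.prems
    by (cases b; cases c) (auto simp: dotp_add_left dotp_scale_left)
  have IH: "list_mean (length rs) (\<lambda>cs. load_mgf t (shear r rs cs) (?P T0 b \<union> ?P T1 d)) =
      load_mgf t rs (?P T0 b) * load_mgf t rs (?P T1 d)" for b d
    by (rule Cons.IH) (use Cons.prems in auto)
  have "list_mean (length (s # rs)) (\<lambda>cs. load_mgf t (shear r (s # rs) cs) (T0 \<union> T1)) =
      mean (\<lambda>c. list_mean (length rs) (\<lambda>cs.
        (1/2) * (load_mgf t (shear r rs cs) (?P T0 0 \<union> ?P T1 (0 + c)) +
          load_mgf t (shear r rs cs) (?P T0 1 \<union> ?P T1 (1 + c)))))"
    by (simp only: list.size list_mean_Suc add_0_right add_Suc_right shear_simps load_mgf.simps split)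
      simp
  also have "\<dots> = mean (\<lambda>c. (1/2) * (load_mgf t rs (?P T0 0) * load_mgf t rs (?P T1 (0 + c)) +
          load_mgf t rs (?P T0 1) * load_mgf t rs (?P T1 (1 + c))))"
    by (simp only: list_mean_cmult list_mean_add IH)
  \<comment> \<open>As \<open>c\<close> varies, each half of \<open>T0\<close> meets each half of
    \<open>T1\<close> once; the four products, each with weight 1/4, factor.\<close>
  also have "\<dots> = load_mgf t (s # rs) T0 * load_mgf t (s # rs) T1"
    by (simp add: mean_bit field_simps)
  finally show ?case .
qed

section \<open>Expected logarithm when a row is added\<close>

definition mean_log_mgf :: "real \<Rightarrow> (bit ^ 'u) set \<Rightarrow> nat \<Rightarrow> real" where
  "mean_log_mgf t T m = list_mean m (\<lambda>rs. ln (load_mgf t rs T))"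

lemma mean_log_mgf_step:
  fixes T :: "(bit ^ 'u) set"
  shows "mean_log_mgf t T m \<le> 2 * mean_log_mgf t T (Suc m)"
proof -
  \<comment> \<open>The inequality holds for each fixed additional row \<open>r\<close>; averaging
    over \<open>r\<close> comes last.\<close>
  have "mean_log_mgf t T m \<le> 2 * list_mean m (\<lambda>rs. ln (load_mgf t (r # rs) T))" for r
  proof -
    let ?T0 = "{x \<in> T. dotp r x = 0}" and ?T1 = "{x \<in> T. dotp r x = 1}"
    have T: "?T0 \<union> ?T1 = T"
      using bit_not_zero_iff by auto
    have "mean_log_mgf t T m = list_mean m (\<lambda>cs :: bit list. mean_log_mgf t T m)"
      by simp
    also have "\<dots> = list_mean m (\<lambda>cs. list_mean m (\<lambda>rs. ln (load_mgf t (shear r rs cs) T)))"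
      unfolding mean_log_mgf_def
      by (rule list_mean_cong, rule list_mean_shear[symmetric])
    \<comment> \<open>With the shear bits innermost, Jensen applies to them for fixed
      \<open>rs\<close> and leaves the logarithm of a product.\<close>
    also have "\<dots> = list_mean m (\<lambda>rs. list_mean m (\<lambda>cs. ln (load_mgf t (shear r rs cs) T)))"
      by (rule list_mean_swap)
    also have "\<dots> \<le> list_mean m (\<lambda>rs. 2 * ln (load_mgf t (r # rs) T))"
    proof (rule list_mean_mono)
      fix rs :: "(bit ^ 'u) list"
      assume len: "length rs = m"
      define a b where "a = load_mgf t rs ?T0" and "b = load_mgf t rs ?T1"
      have ab: "a > 0" "b > 0"
        by (simp_all add: a_def b_def load_mgf_pos)
      have "list_mean m (\<lambda>cs. ln (load_mgf t (shear r rs cs) T)) \<le>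
          ln (list_mean m (\<lambda>cs. load_mgf t (shear r rs cs) T))"
        by (rule list_mean_ln_le) (rule load_mgf_pos)
      also have "list_mean m (\<lambda>cs. load_mgf t (shear r rs cs) T) = a * b"
      proof -
        have "list_mean (length rs) (\<lambda>cs. load_mgf t (shear r rs cs) (?T0 \<union> ?T1)) = a * b"
          unfolding a_def b_def by (rule list_mean_load_mgf_shear) auto
        then show ?thesis
          unfolding T len .
      qed
      also have "ln (a * b) \<le> ln (((a + b) / 2)\<^sup>2)"
      proof -
        have "((a + b) / 2)\<^sup>2 - a * b = ((a - b) / 2)\<^sup>2"
          by (simp add: power2_eq_square field_simps)
        then have "a * b \<le> ((a + b) / 2)\<^sup>2"
          by (smt (verit) zero_le_power2)
        then show ?thesis
          using ab by simp
      qed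
      also have "\<dots> = 2 * ln (load_mgf t (r # rs) T)"
        using ab by (simp add: ln_realpow a_def b_def)
      finally show "list_mean m (\<lambda>cs. ln (load_mgf t (shear r rs cs) T)) \<le>
          2 * ln (load_mgf t (r # rs) T)" .
    qed
    finally show ?thesis
      by (simp add: list_mean_cmult)
  qed
  then have "mean (\<lambda>r :: bit ^ 'u. mean_log_mgf t T m) \<le>
      mean (\<lambda>r. 2 * list_mean m (\<lambda>rs. ln (load_mgf t (r # rs) T)))"
    by (intro mean_mono)
  then show ?thesis
    by (simp add: mean_cmult mean_log_mgf_def list_mean_Suc)
qed

lemma mean_log_mgf_le_iterate: "mean_log_mgf t T m \<le> 2 ^ k * mean_log_mgf t T (m + k)"
proof (induction k)
  case 0
  then show ?case by simp
next
  case (Suc k)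
  have "2 ^ k * mean_log_mgf t T (m + k) \<le> 2 ^ k * (2 * mean_log_mgf t T (m + Suc k))"
    using mean_log_mgf_step[of t T "m + k"] by (intro mult_left_mono) simp_all
  with Suc have "mean_log_mgf t T m \<le> 2 ^ k * (2 * mean_log_mgf t T (m + Suc k))"
    by (rule order_trans)
  then show ?case
    by (simp add: ac_simps)
qed

section \<open>Collisions and the limit of many rows\<close>

definition distinct_pairs :: "'a set \<Rightarrow> ('a \<times> 'a) set" where
  "distinct_pairs T = {(x, y) \<in> T \<times> T. x \<noteq> y}"

text \<open>Points \<open>x \<noteq> y\<close> fall into the same half exactly when \<open>r\<close>
  is orthogonal to \<open>x + y \<noteq> 0\<close>, which has probability 1/2. Thus each row halves
  the expected number of colliding pairs.\<close>

lemma mean_card_distinct_pairs: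
  fixes T :: "(bit ^ 'u) set"
  shows "mean (\<lambda>r. real (card (distinct_pairs {x \<in> T. dotp r x = 0})) +
      real (card (distinct_pairs {x \<in> T. dotp r x = 1}))) = card (distinct_pairs T) / 2"
proof -
  have pairs: "real (card (distinct_pairs {x \<in> T. dotp r x = 0})) +
      real (card (distinct_pairs {x \<in> T. dotp r x = 1})) =
      (\<Sum>p\<in>distinct_pairs T. of_bool (dotp r (fst p + snd p) = 0))" for r
  proof -
    have un: "{p \<in> distinct_pairs T. dotp r (fst p + snd p) = 0} =
        distinct_pairs {x \<in> T. dotp r x = 0} \<union> distinct_pairs {x \<in> T. dotp r x = 1}"
      by (auto simp: distinct_pairs_def dotp_add_right)
    have "(\<Sum>p\<in>distinct_pairs T. of_bool (dotp r (fst p + snd p) = 0)) =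
        real (card {p \<in> distinct_pairs T. dotp r (fst p + snd p) = 0})"
      by (simp add: Int_def)
    also have "\<dots> = real (card (distinct_pairs {x \<in> T. dotp r x = 0})) +
      real (card (distinct_pairs {x \<in> T. dotp r x = 1}))"
      unfolding un by (subst card_Un_disjoint) (auto simp: distinct_pairs_def)
    finally show ?thesis ..
  qed
  have half: "mean (\<lambda>r :: bit ^ 'u. of_bool (dotp r (fst p + snd p) = 0)) = 1 / 2"
    if "p \<in> distinct_pairs T" for p
  proof -
    have "fst p + snd p \<noteq> 0"
    proof
      assume "fst p + snd p = 0"
      then have "fst p = snd p"
        by (metis add.right_neutral bit_vec_add_self_left)
      with that show False
        by (auto simp: distinct_pairs_def)
    qed
    from card_dotp_eq_0[OF this]
    have "2 * real (card {r :: bit ^ 'u. dotp r (fst p + snd p) = 0}) = real CARD(bit ^ 'u)"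
      by (metis of_nat_mult of_nat_numeral)
    then show ?thesis
      by (simp add: mean_def field_simps)
  qed
  have "mean (\<lambda>r. \<Sum>p\<in>distinct_pairs T. of_bool (dotp r (fst p + snd p) = 0)) =
      (\<Sum>p\<in>distinct_pairs T. mean (\<lambda>r. of_bool (dotp r (fst p + snd p) = 0)))"
    unfolding mean_def by (subst sum.swap) (simp add: sum_divide_distrib)
  also have "\<dots> = card (distinct_pairs T) / 2"
    by (simp only: half sum_constant cong: sum.cong)
  finally show ?thesis
    unfolding pairs .
qed

text \<open>The error term accounts for the collisions of \<open>T\<close> under \<open>m\<close> random rows; it vanishes
  as \<open>m\<close> grows.\<close>

lemma list_mean_load_mgf_le:
  fixes T :: "(bit ^ 'u) set" and t :: real
  assumes "t \<ge> 0" "card T \<le> n"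
  shows "2 ^ m * (list_mean m (\<lambda>rs. load_mgf t rs T) - 1) \<le>
    card T * (exp t - 1) + exp (t * n) * card (distinct_pairs T) / 2 ^ m"
  using assms(2)
proof (induction m arbitrary: T)
  case 0
  show ?case
  \<comment> \<open>With at most one point equality holds; otherwise a single pair already makes the
    error term at least \<open>exp (t * n)\<close>.\<close>
  proof (cases "card T \<le> 1")
    case True
    then consider "card T = 0" | "card T = 1" by linarith
    then show ?thesis by cases auto
  next
    case False
    then obtain x y where "x \<in> T" "y \<in> T" "x \<noteq> y"
      by (metis card_le_Suc0_iff_eq finite One_nat_def)
    then have "card (distinct_pairs T) > 0"
      by (auto simp: card_gt_0_iff distinct_pairs_def)
    then have "exp (t * n) * 1 \<le> exp (t * n) * card (distinct_pairs T)"
      by (intro mult_left_mono) auto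
    moreover have "exp (t * card T) \<le> exp (t * n)"
      using 0 assms(1) by (simp add: mult_left_mono)
    moreover have "card T * (exp t - 1) \<ge> 0"
      using assms(1) by simp
    ultimately show ?thesis
      by (simp only: list_mean_0 load_mgf.simps power_0 div_by_1 mult_1_left mult_1_right)
  qed
next
  case (Suc m)
  define P where "P r b = {x \<in> T. dotp r x = b}" for r b
  define G where "G U = 2 ^ m * (list_mean m (\<lambda>rs. load_mgf t rs U) - 1)" for U :: "(bit ^ 'u) set"
  \<comment> \<open>\<open>n\<close> is kept apart from \<open>card T\<close> so that the factor
    \<open>exp (t * n)\<close> stays the same when \<open>T\<close> is replaced by a half.\<close>
  have IH: "G (P r b) \<le> card (P r b) * (exp t - 1) +
      exp (t * n) * card (distinct_pairs (P r b)) / 2 ^ m" for r b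
  proof -
    have "card (P r b) \<le> card T"
      by (auto simp: P_def intro: card_mono)
    with Suc show ?thesis
      unfolding G_def by (meson order_trans)
  qed
  have cardT: "real (card T) = card (P r 0) + card (P r 1)" for r
  proof -
    have "T = P r 0 \<union> P r 1"
      using bit_not_zero_iff by (auto simp: P_def)
    moreover have "P r 0 \<inter> P r 1 = {}"
      by (auto simp: P_def)
    ultimately have "card T = card (P r 0) + card (P r 1)"
      by (metis card_Un_disjoint finite)
    then show ?thesis by simp
  qed
  have "list_mean (Suc m) (\<lambda>rs. load_mgf t rs T) =
      mean (\<lambda>r. list_mean m (\<lambda>rs. (1/2) * (load_mgf t rs (P r 0) + load_mgf t rs (P r 1))))"
    by (simp add: list_mean_Suc P_def)
  also have "\<dots> = mean (\<lambda>r. 1 + (1 / 2 ^ Suc m) * (G (P r 0) + G (P r 1)))"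
    by (rule arg_cong[of _ _ mean])
      (simp only: list_mean_cmult list_mean_add G_def, simp add: fun_eq_iff field_simps)
  also have "\<dots> = 1 + (1 / 2 ^ Suc m) * mean (\<lambda>r. G (P r 0) + G (P r 1))"
    by (simp only: mean_add mean_cmult mean_const)
  finally have "2 ^ Suc m * (list_mean (Suc m) (\<lambda>rs. load_mgf t rs T) - 1) =
      mean (\<lambda>r. G (P r 0) + G (P r 1))"
    by simp
  also have "\<dots> \<le> mean (\<lambda>r. card T * (exp t - 1) + (exp (t * n) / 2 ^ m) *
      (real (card (distinct_pairs (P r 0))) + real (card (distinct_pairs (P r 1)))))"
  proof (rule mean_mono)
    fix r
    show "G (P r 0) + G (P r 1) \<le> card T * (exp t - 1) + (exp (t * n) / 2 ^ m) *
      (real (card (distinct_pairs (P r 0))) + real (card (distinct_pairs (P r 1))))"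
      using IH[of r 0] IH[of r 1] unfolding cardT[of r]
      by (simp add: distrib_left distrib_right add_divide_distrib)
  qed
  also have "\<dots> = card T * (exp t - 1) + (exp (t * n) / 2 ^ m) * (card (distinct_pairs T) / 2)"
    using mean_card_distinct_pairs[of T]
    by (simp only: mean_add mean_cmult mean_const P_def)
  also have "\<dots> = card T * (exp t - 1) + exp (t * n) * card (distinct_pairs T) / 2 ^ Suc m"
    by simp
  finally show ?case .
qed

text \<open>Pass to \<open>m + k\<close> rows, where \<open>ln x \<le> x - 1\<close> brings in the
  bound on the plain average; the collision term vanishes as \<open>k\<close> grows.\<close>

lemma mean_log_mgf_bound:
  fixes T :: "(bit ^ 'u) set" and t :: real
  assumes "t \<ge> 0"
  shows "2 ^ m * mean_log_mgf t T m \<le> card T * (exp t - 1)"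
proof -
  define C where "C = exp (t * card T) * card (distinct_pairs T)"
  have bound: "2 ^ m * mean_log_mgf t T m \<le> card T * (exp t - 1) + C / 2 ^ (m + k)" for k
  proof -
    have "mean_log_mgf t T (m + k) \<le> list_mean (m + k) (\<lambda>rs. load_mgf t rs T + (- 1))"
      unfolding mean_log_mgf_def
      by (intro list_mean_mono) (use ln_le_minus_one[OF load_mgf_pos] in simp)
    also have "\<dots> = list_mean (m + k) (\<lambda>rs. load_mgf t rs T) - 1"
      by (simp only: list_mean_add list_mean_const)
    finally have "2 ^ (m + k) * mean_log_mgf t T (m + k) \<le>
        2 ^ (m + k) * (list_mean (m + k) (\<lambda>rs. load_mgf t rs T) - 1)"
      by (intro mult_left_mono) simp_all
    moreover have "2 ^ m * mean_log_mgf t T m \<le> 2 ^ m * (2 ^ k * mean_log_mgf t T (m + k))"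
      by (intro mult_left_mono mean_log_mgf_le_iterate) simp
    ultimately show ?thesis
      using list_mean_load_mgf_le[where T = T and m = "m + k", OF assms order_refl]
      by (simp only: C_def power_add mult.assoc)
  qed
  have "(\<lambda>k. C / 2 ^ m * (1 / 2) ^ k) \<longlonglongrightarrow> C / 2 ^ m * 0"
    by (intro tendsto_intros LIMSEQ_power_zero) simp
  then have "(\<lambda>k. card T * (exp t - 1) + C / 2 ^ (m + k)) \<longlonglongrightarrow> card T * (exp t - 1) + 0"
    by (intro tendsto_intros) (simp add: power_add power_divide)
  then show ?thesis
    using bound by (intro LIMSEQ_le_const) auto
qed

section \<open>From random linear maps to random lists of rows\<close>

lemma matrix_vector_component: "(A *v x) $ i = dotp (A $ i) x"
  by (simp add: matrix_vector_mult_def dotp_def)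

text \<open>Listing the matrix rows along \<open>idx\<close> is a bijection from linear maps to
  lists of length \<open>CARD('l)\<close>, so a uniform map has a uniform list of rows.\<close>

lemma expectation_linear_maps:
  fixes F :: "(bit ^ 'u \<Rightarrow> bit ^ 'l) \<Rightarrow> real" and idx :: "'l list"
  assumes "distinct idx" "set idx = UNIV"
    and "\<And>h. h \<in> linear_maps \<Longrightarrow> F h \<le> G (map (\<lambda>i. matrix h $ i) idx)"
  shows "measure_pmf.expectation (pmf_of_set linear_maps) F \<le> list_mean CARD('l) G"
proof -
  let ?L = "linear_maps :: (bit ^ 'u \<Rightarrow> bit ^ 'l) set"
  have len: "length idx = CARD('l)"
    using assms(1,2) by (metis distinct_card)
  define rows where "rows h = map (\<lambda>i. matrix h $ i) idx" for h :: "bit ^ 'u \<Rightarrow> bit ^ 'l"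
  have inj: "inj_on rows ?L"
  proof (rule inj_onI)
    fix h g assume hg: "h \<in> ?L" "g \<in> ?L" "rows h = rows g"
    then have "matrix h = matrix g"
      using assms(2) by (simp add: rows_def vec_eq_iff)
    then show "h = g"
      using hg(1,2) matrix_works unfolding linear_maps_def by (metis ext mem_Collect_eq)
  qed
  have surj: "rows ` ?L = {rs. length rs = CARD('l)}"
  proof (intro equalityI subsetI)
    fix rs assume "rs \<in> rows ` ?L"
    then show "rs \<in> {rs. length rs = CARD('l)}"
      using len by (auto simp: rows_def)
  next
    fix rs :: "(bit ^ 'u) list"
    assume "rs \<in> {rs. length rs = CARD('l)}"
    then have lrs: "length rs = length idx"
      using len by simp
    \<comment> \<open>The matrix whose row at index \<open>idx ! k\<close> is
      \<open>rs ! k\<close>.\<close>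
    define A :: "bit ^ 'u ^ 'l" where "A = (\<chi> i. the (map_of (zip idx rs) i))"
    have "rows ((*v) A) = rs"
    proof (rule nth_equalityI)
      show "length (rows ((*v) A)) = length rs"
        by (simp add: rows_def lrs)
    next
      fix k assume "k < length (rows ((*v) A))"
      then have k: "k < length idx"
        by (simp add: rows_def)
      then have "map_of (zip idx rs) (idx ! k) = Some (rs ! k)"
        using assms(1) lrs by (simp add: map_of_zip_nth)
      then show "rows ((*v) A) ! k = rs ! k"
        using k by (simp add: rows_def A_def)
    qed
    moreover have "(*v) A \<in> ?L"
      by (simp add: linear_maps_def matrix_vector_mul_linear_gen)
    ultimately show "rs \<in> rows ` ?L"
      by blast
  qed
  have card: "card ?L = CARD(bit ^ 'u) ^ CARD('l)"
    using card_image[OF inj] by (simp only: surj card_lists_of_length)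
  have "measure_pmf.expectation (pmf_of_set ?L) F = (\<Sum>h\<in>?L. F h) / card ?L"
    by (rule integral_pmf_of_set) (simp_all add: linear_maps_nonempty)
  also have "\<dots> \<le> (\<Sum>h\<in>?L. G (rows h)) / card ?L"
    using assms(3) by (intro divide_right_mono sum_mono) (auto simp: rows_def)
  also have "(\<Sum>h\<in>?L. G (rows h)) = (\<Sum>rs | length rs = CARD('l). G rs)"
    using sum.reindex[OF inj, of G] by (simp add: surj)
  also have "\<dots> / card ?L = list_mean CARD('l) G"
    unfolding list_mean_def card by simp
  finally show ?thesis .
qed

text \<open>The exponential of the largest load is at most the sum over all
  \<open>2 ^ CARD('l)\<close> values \<open>y\<close>; passing from the average to this sum costs
  \<open>CARD('l) * ln 2\<close> after taking logarithms.\<close>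

lemma expectation_max_load_le:
  fixes S :: "(bit ^ 'u) set" and t :: real
  assumes "t > 0"
  shows "measure_pmf.expectation
      (pmf_of_set (linear_maps :: (bit ^ 'u \<Rightarrow> bit ^ 'l) set))
      (\<lambda>h. real (MAX y. card (h -` {y} \<inter> S)))
    \<le> (CARD('l) * ln 2 + card S * (exp t - 1) / 2 ^ CARD('l)) / t"
proof -
  obtain idx :: "'l list" where idx: "distinct idx" "set idx = UNIV"
    using finite_distinct_list[of "UNIV :: 'l set"] by auto
  then have len: "length idx = CARD('l)"
    by (metis distinct_card)
  let ?l = "CARD('l)"
  let ?G = "\<lambda>rs. (1 / t) * (?l * ln 2 + ln (load_mgf t rs S))"
  have "measure_pmf.expectation (pmf_of_set (linear_maps :: (bit ^ 'u \<Rightarrow> bit ^ 'l) set))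
      (\<lambda>h. real (MAX y. card (h -` {y} \<inter> S))) \<le> list_mean ?l ?G"
  proof (rule expectation_linear_maps[OF idx])
    fix h :: "bit ^ 'u \<Rightarrow> bit ^ 'l"
    assume "h \<in> linear_maps"
    then have h: "h x = matrix h *v x" for x
      by (simp add: linear_maps_def matrix_works)
    define rs where "rs = map (\<lambda>i. matrix h $ i) idx"
    have "(MAX y. card (h -` {y} \<inter> S)) \<in> range (\<lambda>y. card (h -` {y} \<inter> S))"
      by (rule Max_in) auto
    then obtain y where y: "(MAX y. card (h -` {y} \<inter> S)) = card (h -` {y} \<inter> S)"
      by blast
    have "h x = y \<longleftrightarrow> map (\<lambda>r. dotp r x) rs = map (\<lambda>i. y $ i) idx" for x
      using idx(2) by (simp add: rs_def h vec_eq_iff matrix_vector_component)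
    then have "h -` {y} \<inter> S = {x \<in> S. map (\<lambda>r. dotp r x) rs = map (\<lambda>i. y $ i) idx}"
      by auto
    then have "exp (t * card (h -` {y} \<inter> S)) \<le> 2 ^ ?l * load_mgf t rs S"
      using exp_load_le_load_mgf[where ys = "map (\<lambda>i. y $ i) idx" and rs = rs and t = t and T = S] by (simp add: rs_def len)
    then have "t * card (h -` {y} \<inter> S) \<le> ln (2 ^ ?l * load_mgf t rs S)"
      using load_mgf_pos[of t rs S] by (subst ln_ge_iff) auto
    also have "\<dots> = ?l * ln 2 + ln (load_mgf t rs S)"
      using load_mgf_pos[of t rs S] by (simp add: ln_mult ln_realpow)
    finally show "real (MAX y. card (h -` {y} \<inter> S)) \<le> ?G (map (\<lambda>i. matrix h $ i) idx)"
      using assms by (simp add: y rs_def field_simps)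
  qed
  also have "\<dots> = (1 / t) * (?l * ln 2 + mean_log_mgf t S ?l)"
    by (simp only: list_mean_cmult list_mean_add list_mean_const mean_log_mgf_def)
  also have "\<dots> \<le> (1 / t) * (?l * ln 2 + card S * (exp t - 1) / 2 ^ ?l)"
    using mean_log_mgf_bound[where t = t and m = ?l and T = S] assms
    by (intro mult_left_mono add_left_mono) (simp_all add: field_simps)
  finally show ?thesis by simp
qed

theorem theorem1p1:
  fixes S :: "(bit ^ 'u) set" and n :: nat
  assumes "CARD('l) \<ge> 1"
    and "CARD('u) \<ge> CARD('l)"
    and "n = 2 ^ CARD('l)"
    and "card S = n"
  shows "ereal (measure_pmf.expectation
            (pmf_of_set (linear_maps :: (bit ^ 'u \<Rightarrow> bit ^ 'l) set))
            (\<lambda>h. real (MAX y. card (h -` {y} \<inter> S))))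
         \<le> ereal (16 * log 2 n) / ereal (log 2 (log 2 n))"
proof (cases "CARD('l) \<ge> 2")
  \<comment> \<open>Here \<open>log 2 (log 2 n) = 0\<close>, and the right side is infinite.\<close>
  case False
  then have "CARD('l) = 1"
    using assms(1) by linarith
  then have "n = 2"
    using assms(3) by simp
  then show ?thesis
    using ereal_bound_at_2 by simp
next
  case True
  let ?l = "real CARD('l)"
  \<comment> \<open>The choice \<open>t = ln ?l\<close> gives \<open>exp t = ?l\<close>, so both
    terms of the numerator are linear in \<open>?l\<close>.\<close>
  have t: "ln ?l > 0"
    using True by simp
  have "measure_pmf.expectation (pmf_of_set (linear_maps :: (bit ^ 'u \<Rightarrow> bit ^ 'l) set))
      (\<lambda>h. real (MAX y. card (h -` {y} \<inter> S)))
    \<le> (?l * ln 2 + card S * (exp (ln ?l) - 1) / 2 ^ CARD('l)) / ln ?l"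
    by (rule expectation_max_load_le[OF t])
  also have "\<dots> = (?l * ln 2 + (?l - 1)) / ln ?l"
    using True assms(3,4) by simp
  also have "\<dots> \<le> 16 * ?l * ln 2 / ln ?l"
  proof (rule divide_right_mono)
    \<comment> \<open>This gives \<open>?l \<le> 2 * ?l * ln 2\<close>, so already
      \<open>3 * ?l * ln 2\<close> bounds the numerator.\<close>
    have "1 / 2 \<le> ln (2::real)"
      using ln2_ge_two_thirds by simp
    then have "?l * (1 / 2) \<le> ?l * ln 2"
      by (intro mult_left_mono) simp_all
    moreover have "?l \<ge> 0"
      by simp
    ultimately show "?l * ln 2 + (?l - 1) \<le> 16 * ?l * ln 2"
      unfolding mult.assoc by linarith
  qed (use t in simp)
  \<comment> \<open>The factor \<open>ln 2\<close> is absorbed by the change of base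
    \<open>log 2 ?l = ln ?l / ln 2\<close>.\<close>
  also have "\<dots> = 16 * log 2 n / log 2 (log 2 n)"
    using assms(3) by (simp add: log_nat_power log_def[of 2 ?l])
  finally show ?thesis
    unfolding ereal_bound_above_2[OF True assms(3)] by simp
qed

end
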